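(* Let $n$ be an integer with $1<n<\omega$. Every topological space $(X,\mathcal{T})$ which is $(n+1)$-resolvable and not $\omega$-resolvable admits an expansion $\mathcal{U}\supseteq\mathcal{T}$ such that $(X,\mathcal{U})$ is exactly $n$-resolvable and $(X,\mathcal{U})$ is not quasi-regular.
   Context: No separation axioms are assumed of topological spaces. For a (possibly finite) cardinal $\kappa>1$, a space is $\kappa$-resolvable if there is a family of $\kappa$-many pairwise disjoint nonempty subsets, each dense in the space. For finite $n>1$, a space is exactly $n$-resolvable if it is $n$-resolvable but not $(n+1)$-resolvable. An expansion of a topology $\mathcal{T}$ on a set $X$ is a topology $\mathcal{U}$ on $X$ with $\mathcal{U}\supseteq\mathcal{T}$. A space $(X,\mathcal{T})$ is quasi-regular if for every nonempty $U\in\mathcal{T}$ there is a nonempty $V\in\mathcal{T}$ whose closure in $(X,\mathcal{T})$ is contained in $U$. *)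

theory Defs
  imports "HOL-Analysis.Analysis"
begin

definition dense_in :: "'a topology \<Rightarrow> 'a set \<Rightarrow> bool" where
  "dense_in X D \<longleftrightarrow> D \<subseteq> topspace X \<and> X closure_of D = topspace X"

text \<open>
  A cardinal is represented by any set \<open>K\<close> of that cardinality: a finite \<open>n\<close> by \<open>{..<n}\<close>, and
  \<open>\<omega>\<close> by \<open>UNIV :: nat set\<close>. Pairwise disjoint nonempty sets are distinct, so a family of
  that many members is the same as a set \<open>\<F>\<close> with \<open>\<F> \<approx> K\<close>. The notion is meant for
  cardinals greater than 1 only.
\<close>

definition resolvable :: "'k set \<Rightarrow> 'a topology \<Rightarrow> bool" where
  "resolvable K X \<longleftrightarrow>
     (\<exists>\<F>. \<F> \<approx> K \<and> pairwise disjnt \<F> \<and> (\<forall>D\<in>\<F>. D \<noteq> {} \<and> dense_in X D))"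

definition exactly_resolvable :: "nat \<Rightarrow> 'a topology \<Rightarrow> bool" where
  "exactly_resolvable n X \<longleftrightarrow> resolvable {..<n} X \<and> \<not> resolvable {..<n + 1} X"

definition expansion_of :: "'a topology \<Rightarrow> 'a topology \<Rightarrow> bool" where
  "expansion_of T U \<longleftrightarrow> topspace U = topspace T \<and> (\<forall>S. openin T S \<longrightarrow> openin U S)"

definition quasi_regular :: "'a topology \<Rightarrow> bool" where
  "quasi_regular X \<longleftrightarrow>
     (\<forall>U. openin X U \<and> U \<noteq> {} \<longrightarrow> (\<exists>V. openin X V \<and> V \<noteq> {} \<and> X closure_of V \<subseteq> U))"

end

theory Submission
  imports Defs
begin

text \<open>
  Some nonempty open set contains no nonempty \<open>\<omega>\<close>-resolvable open set. Inside it, every dense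
  set \<open>D\<close> has a subset which is dense and hereditarily irresolvable over some smaller open set, as
  otherwise \<open>D\<close> could be halved again and again, giving infinitely many disjoint dense sets.
  Starting from disjoint dense sets \<open>D\<^sub>0, \<dots>, D\<^sub>n\<close>, this yields an open \<open>W\<close> and sets
  \<open>E\<^sub>i \<subseteq> D\<^sub>i\<close> for \<open>i < n\<close>, dense and hereditarily irresolvable over \<open>W\<close>. Let
  \<open>A = W \<inter> (E\<^sub>0 \<union> \<dots> \<union> E\<^sub>n\<^sub>-\<^sub>1)\<close> and expand the topology by making \<open>A\<close> open. The sets
  \<open>E\<^sub>i \<union> (D\<^sub>i - W)\<close> remain dense. Over a small enough open set, the trace of each \<open>E\<^sub>i\<close> lies inside or outside
  each member of a given finite family, so \<open>n + 1\<close> disjoint dense sets are impossible by the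
  pigeonhole principle. Points of \<open>D\<^sub>n\<close> have only their old neighbourhoods, so the closure of an
  nonempty open subset of \<open>A\<close> always leaves \<open>A\<close>.
\<close>

section \<open>Density and disjoint dense families relative to an open set\<close>

definition dense_over :: "'a topology \<Rightarrow> 'a set \<Rightarrow> 'a set \<Rightarrow> bool" where
  "dense_over X W D \<longleftrightarrow> (\<forall>U. openin X U \<and> U \<subseteq> W \<and> U \<noteq> {} \<longrightarrow> U \<inter> D \<noteq> {})"

text \<open>Indexed counterpart of \<open>resolvable\<close>, relative to \<open>W\<close>. The
  pieces need not lie inside \<open>W\<close>, so a splitting over \<open>W\<close> serves unchanged
  over every subset of \<open>W\<close>.\<close>

definition splits_over :: "'k set \<Rightarrow> 'a topology \<Rightarrow> 'a set \<Rightarrow> 'a set \<Rightarrow> bool" where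
  "splits_over K X W S \<longleftrightarrow>
     (\<exists>f. disjoint_family_on f K \<and> (\<forall>i\<in>K. f i \<subseteq> S \<and> dense_over X W (f i)))"

text \<open>For \<open>W\<close> open and \<open>E\<close> dense over \<open>W\<close>, this says
  that no nonempty relatively open subset of the subspace \<open>E \<inter> W\<close> is
  2-resolvable; \<open>bool\<close> serves as the index set of size 2.\<close>

definition hereditarily_irresolvable_over :: "'a topology \<Rightarrow> 'a set \<Rightarrow> 'a set \<Rightarrow> bool" where
  "hereditarily_irresolvable_over X W E \<longleftrightarrow>
     (\<forall>V. openin X V \<and> V \<subseteq> W \<and> V \<noteq> {} \<longrightarrow> \<not> splits_over (UNIV :: bool set) X V E)"

lemma dense_overD:
  "\<lbrakk>dense_over X W D; openin X U; U \<subseteq> W; U \<noteq> {}\<rbrakk> \<Longrightarrow> U \<inter> D \<noteq> {}"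
  by (auto simp: dense_over_def)

lemma dense_over_mono:
  "\<lbrakk>dense_over X W D; V \<subseteq> W; D \<subseteq> D'\<rbrakk> \<Longrightarrow> dense_over X V D'"
  unfolding dense_over_def by blast

lemma splits_over_mono:
  assumes "splits_over K X W S" "V \<subseteq> W" "S \<subseteq> S'"
  shows "splits_over K X V S'"
  using assms unfolding splits_over_def by (meson dense_over_mono order_refl order_trans)

lemma hereditarily_irresolvable_over_subset:
  "\<lbrakk>hereditarily_irresolvable_over X W E; V \<subseteq> W\<rbrakk> \<Longrightarrow> hereditarily_irresolvable_over X V E"
  unfolding hereditarily_irresolvable_over_def by blast

lemma dense_in_iff_dense_over:
  "dense_in X D \<longleftrightarrow> D \<subseteq> topspace X \<and> dense_over X (topspace X) D"
  unfolding dense_in_def dense_over_def dense_intersects_open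
  by (metis inf_commute openin_subset)

text \<open>In a nonempty space dense sets are nonempty, so disjoint members of an indexed family
  are distinct and the family can be exchanged for its image.\<close>

lemma resolvable_iff_splits_over:
  assumes "topspace X \<noteq> {}"
  shows "resolvable K X \<longleftrightarrow> splits_over K X (topspace X) (topspace X)"
proof
  assume "resolvable K X"
  then obtain \<F> f where F: "pairwise disjnt \<F>" "\<And>D. D \<in> \<F> \<Longrightarrow> dense_in X D"
    and f: "bij_betw f K \<F>"
    unfolding resolvable_def by (meson eqpoll_def eqpoll_sym)
  have "disjoint_family_on f K"
    unfolding disjoint_family_on_def
    using F(1) bij_betwE[OF f] bij_betw_imp_inj_on[OF f]
    by (metis disjnt_def inj_on_contraD pairwiseD)
  then show "splits_over K X (topspace X) (topspace X)"
    unfolding splits_over_def using F(2) f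
    by (meson bij_betwE dense_in_iff_dense_over)
next
  assume "splits_over K X (topspace X) (topspace X)"
  then obtain f where f: "disjoint_family_on f K"
    "\<And>i. i \<in> K \<Longrightarrow> f i \<subseteq> topspace X \<and> dense_over X (topspace X) (f i)"
    unfolding splits_over_def by blast
  have ne: "f i \<noteq> {}" if "i \<in> K" for i
    using f(2)[OF that] assms by (metis dense_overD inf_bot_right openin_topspace order_refl)
  have "inj_on f K"
    using f(1) ne unfolding disjoint_family_on_def inj_on_def by (metis inf.idem)
  then have "f ` K \<approx> K"
    by (simp add: inj_on_image_eqpoll_self)
  moreover have "pairwise disjnt (f ` K)"
    using f(1) by (rule disjoint_family_on_disjoint_image)
  ultimately show "resolvable K X"
    unfolding resolvable_def using f(2) ne dense_in_iff_dense_over by (metis imageE)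
qed

text \<open>Zorn's lemma gives a maximal disjoint family of open subsets of \<open>W\<close> over
  which \<open>S\<close> splits. By the local hypothesis its union is dense in \<open>W\<close>, so
  the splittings of its members combine into one over \<open>W\<close>.\<close>

lemma splits_over_glue:
  assumes local: "\<And>U. \<lbrakk>openin X U; U \<subseteq> W; U \<noteq> {}\<rbrakk> \<Longrightarrow>
      \<exists>V. openin X V \<and> V \<subseteq> U \<and> V \<noteq> {} \<and> splits_over K X V S"
  shows "splits_over K X W S"
proof -
  define \<V> where "\<V> = {V. openin X V \<and> V \<subseteq> W \<and> V \<noteq> {} \<and> splits_over K X V S}"
  have "\<exists>M\<in>{M. M \<subseteq> \<V> \<and> pairwise disjnt M}.
      \<forall>N\<in>{M. M \<subseteq> \<V> \<and> pairwise disjnt M}. M \<subseteq> N \<longrightarrow> N = M"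
  proof (rule subset_Zorn_nonempty)
    show "{M. M \<subseteq> \<V> \<and> pairwise disjnt M} \<noteq> {}"
      by (auto intro: exI[of _ "{}"])
    fix \<C> assume "subset.chain {M. M \<subseteq> \<V> \<and> pairwise disjnt M} \<C>"
    then have "\<C> \<subseteq> {M. M \<subseteq> \<V> \<and> pairwise disjnt M}" "chain\<^sub>\<subseteq> \<C>"
      by (auto simp: subset_chain_def chain_subset_def)
    then show "\<Union>\<C> \<in> {M. M \<subseteq> \<V> \<and> pairwise disjnt M}"
      using pairwise_chain_Union[of \<C> disjnt] by blast
  qed
  then obtain M where "M \<in> {M. M \<subseteq> \<V> \<and> pairwise disjnt M}"
    and "\<forall>N\<in>{M. M \<subseteq> \<V> \<and> pairwise disjnt M}. M \<subseteq> N \<longrightarrow> N = M" ..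
  then have M: "M \<subseteq> \<V>" "pairwise disjnt M"
    and max: "\<And>N. \<lbrakk>N \<subseteq> \<V>; pairwise disjnt N; M \<subseteq> N\<rbrakk> \<Longrightarrow> N = M"
    by simp_all
  have "\<forall>V\<in>M. \<exists>f. disjoint_family_on f K \<and> (\<forall>i\<in>K. f i \<subseteq> S \<and> dense_over X V (f i))"
    using M(1) unfolding \<V>_def splits_over_def by blast
  then obtain f where f: "\<And>V. V \<in> M \<Longrightarrow> disjoint_family_on (f V) K"
    "\<And>V i. \<lbrakk>V \<in> M; i \<in> K\<rbrakk> \<Longrightarrow> f V i \<subseteq> S \<and> dense_over X V (f V i)"
    by metis
  \<comment> \<open>Cutting \<open>f V i\<close> down to \<open>V\<close> makes pieces coming from
    different members of \<open>M\<close> disjoint.\<close>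
  define g where "g i = (\<Union>V\<in>M. V \<inter> f V i)" for i
  have "disjoint_family_on g K"
    unfolding disjoint_family_on_def
  proof (intro ballI impI, rule ccontr)
    fix i j assume ij: "i \<in> K" "j \<in> K" "i \<noteq> j" "g i \<inter> g j \<noteq> {}"
    then obtain x V V' where x: "V \<in> M" "V' \<in> M" "x \<in> V" "x \<in> V'" "x \<in> f V i" "x \<in> f V' j"
      unfolding g_def by blast
    then have "V = V'"
      using M(2) unfolding pairwise_def disjnt_def by blast
    then show False
      using x f(1)[of V] ij unfolding disjoint_family_on_def by blast
  qed
  moreover have "dense_over X W (g i)" if i: "i \<in> K" for i
    unfolding dense_over_def
  proof (intro allI impI)
    fix U assume "openin X U \<and> U \<subseteq> W \<and> U \<noteq> {}"
    then obtain V where V: "V \<in> \<V>" "V \<subseteq> U"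
      using local[of U] unfolding \<V>_def by blast
    \<comment> \<open>Otherwise \<open>V\<close> could be added to \<open>M\<close>. By maximality
      it would already belong to \<open>M\<close>, yet it is nonempty and so meets itself.\<close>
    have "\<exists>V'\<in>M. V \<inter> V' \<noteq> {}"
    proof (rule ccontr)
      assume none: "\<not> (\<exists>V'\<in>M. V \<inter> V' \<noteq> {})"
      then have "pairwise disjnt (insert V M)"
        using M(2) by (auto simp: pairwise_insert disjnt_def)
      then have "V \<in> M"
        using max[of "insert V M"] M(1) V(1) by blast
      then show False
        using none V(1) unfolding \<V>_def by blast
    qed
    then obtain V' where V': "V' \<in> M" "V \<inter> V' \<noteq> {}"
      by blast
    have "openin X (V \<inter> V')"
      using V(1) V'(1) M(1) unfolding \<V>_def by blast
    then have "V \<inter> V' \<inter> f V' i \<noteq> {}"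
      using f(2)[OF V'(1) i] V'(2) dense_overD by (metis inf_le2)
    then show "U \<inter> g i \<noteq> {}"
      unfolding g_def using V(2) V'(1) by blast
  qed
  ultimately show ?thesis
    unfolding splits_over_def g_def using f(2) by blast
qed

section \<open>Hereditarily irresolvable subsets of dense sets\<close>

text \<open>If this fails, every subset of \<open>R\<close> dense over \<open>W\<close> splits in
  two somewhere below each nonempty open subset of \<open>W\<close>, hence over \<open>W\<close> by
  gluing. Repeated halving then splits \<open>R\<close> into infinitely many pieces.\<close>

lemma ex_hereditarily_irresolvable_over:
  assumes W: "openin X W" "W \<noteq> {}" and R: "dense_over X W R"
    and not_split: "\<not> splits_over (UNIV :: nat set) X W R"
  shows "\<exists>V E. openin X V \<and> V \<subseteq> W \<and> V \<noteq> {} \<and> E \<subseteq> R \<and> dense_over X V E \<and>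
    hereditarily_irresolvable_over X V E"
proof (rule ccontr)
  assume none: "\<not> ?thesis"
  have halve: "\<exists>A B. A \<subseteq> D \<and> B \<subseteq> D \<and> A \<inter> B = {} \<and> dense_over X W A \<and> dense_over X W B"
    if D: "D \<subseteq> R" "dense_over X W D" for D
  proof -
    have "splits_over (UNIV :: bool set) X W D"
    proof (rule splits_over_glue)
      fix U assume U: "openin X U" "U \<subseteq> W" "U \<noteq> {}"
      then have "\<not> hereditarily_irresolvable_over X U D"
        using none D(1) dense_over_mono[OF D(2) U(2) order_refl] by blast
      then show "\<exists>V. openin X V \<and> V \<subseteq> U \<and> V \<noteq> {} \<and> splits_over (UNIV :: bool set) X V D"
        unfolding hereditarily_irresolvable_over_def by blast
    qed
    then obtain f :: "bool \<Rightarrow> 'a set" where "disjoint_family_on f UNIV"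
      "\<And>i. f i \<subseteq> D \<and> dense_over X W (f i)"
      unfolding splits_over_def by blast
    moreover from this(1) have "f True \<inter> f False = {}"
      unfolding disjoint_family_on_def by blast
    ultimately show ?thesis
      by blast
  qed
  then obtain a b where ab: "\<And>D. \<lbrakk>D \<subseteq> R; dense_over X W D\<rbrakk> \<Longrightarrow>
      a D \<subseteq> D \<and> b D \<subseteq> D \<and> a D \<inter> b D = {} \<and> dense_over X W (a D) \<and> dense_over X W (b D)"
    by metis
  \<comment> \<open>\<open>d k\<close> is what remains after \<open>k\<close> halvings;
    \<open>a (d k)\<close> is the half set aside at stage \<open>k\<close>, and later stages work
    inside the other half.\<close>
  define d where "d k = (b ^^ k) R" for k
  have d: "d k \<subseteq> R \<and> dense_over X W (d k)" for k
  proof (induction k)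
    case 0
    then show ?case using R by (simp add: d_def)
  next
    case (Suc k)
    then show ?case using ab[of "d k"] by (auto simp: d_def)
  qed
  have "d (Suc k) \<subseteq> d k" for k
    using ab[of "d k"] d[of k] by (simp add: d_def)
  then have anti: "d l \<subseteq> d k" if "k \<le> l" for k l
    using that by (rule lift_Suc_antimono_le)
  have disj: "a (d k) \<inter> a (d l) = {}" if "k < l" for k l
  proof -
    have "a (d l) \<subseteq> d (Suc k)"
      using ab[of "d l"] d[of l] anti[of "Suc k" l] that by auto
    then show ?thesis
      using ab[of "d k"] d[of k] by (auto simp: d_def)
  qed
  have "disjoint_family_on (\<lambda>k. a (d k)) UNIV"
    unfolding disjoint_family_on_def by (metis disj inf_commute nat_neq_iff)
  moreover have "a (d k) \<subseteq> R \<and> dense_over X W (a (d k))" for k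
    using ab[of "d k"] d[of k] by blast
  ultimately show False
    using not_split unfolding splits_over_def by blast
qed

text \<open>The open set shrinks once per index, and the sets already found keep their properties
  over the smaller one. This is why \<open>not_split\<close> is assumed for all nonempty open
  subsets of \<open>W\<close>.\<close>

lemma ex_hereditarily_irresolvable_over_finite:
  assumes I: "finite I" and W: "openin X W" "W \<noteq> {}"
    and D: "\<And>i. i \<in> I \<Longrightarrow> D i \<subseteq> S \<and> dense_over X W (D i)"
    and not_split: "\<And>V. \<lbrakk>openin X V; V \<subseteq> W; V \<noteq> {}\<rbrakk> \<Longrightarrow> \<not> splits_over (UNIV :: nat set) X V S"
  shows "\<exists>V E. openin X V \<and> V \<subseteq> W \<and> V \<noteq> {} \<and>
    (\<forall>i\<in>I. E i \<subseteq> D i \<and> dense_over X V (E i) \<and> hereditarily_irresolvable_over X V (E i))"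
  using I D
proof (induction I)
  case empty
  then show ?case using W by blast
next
  case (insert j I)
  then obtain V E where V: "openin X V" "V \<subseteq> W" "V \<noteq> {}"
    and E: "\<And>i. i \<in> I \<Longrightarrow> E i \<subseteq> D i \<and> dense_over X V (E i) \<and> hereditarily_irresolvable_over X V (E i)"
    by (metis insert_iff)
  have "dense_over X V (D j)"
    using insert.prems[of j] V(2) dense_over_mono by blast
  moreover have "\<not> splits_over (UNIV :: nat set) X V (D j)"
    using not_split[OF V] splits_over_mono[OF _ order_refl] insert.prems[of j] by blast
  ultimately obtain V' E' where V': "openin X V'" "V' \<subseteq> V" "V' \<noteq> {}"
    and E': "E' \<subseteq> D j" "dense_over X V' E'" "hereditarily_irresolvable_over X V' E'"
    using ex_hereditarily_irresolvable_over[OF V(1) V(3)] by metis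
  have "\<forall>i\<in>insert j I. (E(j := E')) i \<subseteq> D i \<and> dense_over X V' ((E(j := E')) i) \<and>
      hereditarily_irresolvable_over X V' ((E(j := E')) i)"
    using E E' V'(2) by (auto intro: dense_over_mono hereditarily_irresolvable_over_subset)
  moreover have "V' \<subseteq> W"
    using V V' by blast
  ultimately show ?case
    using V' by (intro exI[of _ V'] exI[of _ "E(j := E')"] conjI)
qed

text \<open>\<open>E \<inter> D\<close> and \<open>E - D\<close> cannot both be dense over
  \<open>W\<close>, so some nonempty open \<open>V\<close> misses one of them.\<close>

lemma hereditarily_irresolvable_over_decide:
  assumes "hereditarily_irresolvable_over X W E" "openin X W" "W \<noteq> {}"
  shows "\<exists>V. openin X V \<and> V \<subseteq> W \<and> V \<noteq> {} \<and> (E \<inter> V \<subseteq> D \<or> E \<inter> V \<inter> D = {})"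
proof -
  define f where "f c = (if c then E \<inter> D else E - D)" for c
  have "disjoint_family_on f UNIV" "\<And>c. f c \<subseteq> E"
    by (auto simp: f_def disjoint_family_on_def)
  moreover have "\<not> splits_over (UNIV :: bool set) X W E"
    using assms unfolding hereditarily_irresolvable_over_def by blast
  ultimately obtain c where "\<not> dense_over X W (f c)"
    unfolding splits_over_def by blast
  then obtain V where "openin X V" "V \<subseteq> W" "V \<noteq> {}" "V \<inter> f c = {}"
    unfolding dense_over_def by blast
  then show ?thesis
    by (intro exI[of _ V]) (auto simp: f_def split: if_splits)
qed

text \<open>A decision made over an open set persists over its subsets, so the pairs can be treated
  one after another.\<close>

lemma hereditarily_irresolvable_over_decide_finite:
  assumes "finite P" "openin X W" "W \<noteq> {}"
    and "\<And>E D. (E, D) \<in> P \<Longrightarrow> hereditarily_irresolvable_over X W E"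
  shows "\<exists>V. openin X V \<and> V \<subseteq> W \<and> V \<noteq> {} \<and> (\<forall>(E, D)\<in>P. E \<inter> V \<subseteq> D \<or> E \<inter> V \<inter> D = {})"
  using assms(1,4)
proof (induction P)
  case empty
  then show ?case using assms by blast
next
  case (insert p P)
  then obtain V where V: "openin X V" "V \<subseteq> W" "V \<noteq> {}"
    and P: "\<forall>(E, D)\<in>P. E \<inter> V \<subseteq> D \<or> E \<inter> V \<inter> D = {}"
    using insert.IH by (meson insertI2)
  obtain E D where p: "p = (E, D)"
    by (cases p)
  have "hereditarily_irresolvable_over X V E"
    using insert.prems[of E D] p V(2) hereditarily_irresolvable_over_subset by blast
  then obtain V' where "openin X V'" "V' \<subseteq> V" "V' \<noteq> {}" "E \<inter> V' \<subseteq> D \<or> E \<inter> V' \<inter> D = {}"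
    using hereditarily_irresolvable_over_decide V by metis
  moreover have "E \<inter> V' \<subseteq> D \<or> E \<inter> V' \<inter> D = {}" if "(E, D) \<in> P" for E D
    using P that \<open>V' \<subseteq> V\<close> by blast
  ultimately show ?case
    using V(2) p by (intro exI[of _ V']) auto
qed

section \<open>Adding one open set to a topology\<close>

text \<open>The simple extension of a topology: for \<open>A \<subseteq> topspace X\<close>, the
  coarsest topology that contains \<open>A\<close> and all open sets of \<open>X\<close>.\<close>

definition add_open :: "'a topology \<Rightarrow> 'a set \<Rightarrow> 'a topology" where
  "add_open X A = topology (\<lambda>S. \<exists>V V'. openin X V \<and> openin X V' \<and> S = V \<union> V' \<inter> A)"

lemma openin_add_open:
  "openin (add_open X A) S \<longleftrightarrow> (\<exists>V V'. openin X V \<and> openin X V' \<and> S = V \<union> V' \<inter> A)"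
proof -
  have "istopology (\<lambda>S. \<exists>V V'. openin X V \<and> openin X V' \<and> S = V \<union> V' \<inter> A)"
    unfolding istopology_def
  proof (intro conjI allI impI)
    fix S S'
    assume "\<exists>V V'. openin X V \<and> openin X V' \<and> S = V \<union> V' \<inter> A"
      and "\<exists>V V'. openin X V \<and> openin X V' \<and> S' = V \<union> V' \<inter> A"
    then obtain V V' U U' where *: "openin X V" "openin X V'" "S = V \<union> V' \<inter> A"
      "openin X U" "openin X U'" "S' = U \<union> U' \<inter> A"
      by blast
    then have "openin X (V \<inter> U)" "openin X ((V \<inter> U') \<union> (V' \<inter> U) \<union> (V' \<inter> U'))"
      by blast+
    moreover have "S \<inter> S' = V \<inter> U \<union> ((V \<inter> U') \<union> (V' \<inter> U) \<union> (V' \<inter> U')) \<inter> A"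
      using * by blast
    ultimately show "\<exists>V V'. openin X V \<and> openin X V' \<and> S \<inter> S' = V \<union> V' \<inter> A"
      by blast
  next
    fix \<K> assume "\<forall>S\<in>\<K>. \<exists>V V'. openin X V \<and> openin X V' \<and> S = V \<union> V' \<inter> A"
    then obtain f g where fg: "\<And>S. S \<in> \<K> \<Longrightarrow> openin X (f S) \<and> openin X (g S) \<and> S = f S \<union> g S \<inter> A"
      by metis
    have "openin X (\<Union>(f ` \<K>))" "openin X (\<Union>(g ` \<K>))"
      using fg by auto
    moreover have "\<Union>\<K> = \<Union>(f ` \<K>) \<union> \<Union>(g ` \<K>) \<inter> A"
      using fg by blast
    ultimately show "\<exists>V V'. openin X V \<and> openin X V' \<and> \<Union>\<K> = V \<union> V' \<inter> A"
      by blast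
  qed
  then show ?thesis
    by (simp add: add_open_def topology_inverse')
qed

lemma openin_add_open_mono: "openin X S \<Longrightarrow> openin (add_open X A) S"
  unfolding openin_add_open by (metis inf_bot_left openin_empty sup_bot_right)

lemma topspace_add_open:
  assumes "A \<subseteq> topspace X"
  shows "topspace (add_open X A) = topspace X"
proof
  show "topspace (add_open X A) \<subseteq> topspace X"
    using openin_topspace[of "add_open X A"] openin_subset[of X] unfolding openin_add_open by blast
  show "topspace X \<subseteq> topspace (add_open X A)"
    by (rule openin_subset[OF openin_add_open_mono]) simp
qed

section \<open>The expansion and its properties\<close>

theorem theorem3p3:
  fixes n :: nat and T :: "'a topology"
  assumes "1 < n"
    and "resolvable {..<n + 1} T"
    and "\<not> resolvable (UNIV :: nat set) T"
  shows "\<exists>U. expansion_of T U \<and> exactly_resolvable n U \<and> \<not> quasi_regular U"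
proof -
  have ne: "topspace T \<noteq> {}"
  proof -
    obtain \<F> where "\<F> \<approx> {..<n + 1}" "\<forall>D\<in>\<F>. D \<noteq> {} \<and> dense_in T D"
      using assms(2) unfolding resolvable_def by blast
    moreover from this(1) have "\<F> \<noteq> {}"
      using eqpoll_sym[of "{}" "{..<n + 1}"] by fastforce
    ultimately show ?thesis
      unfolding dense_in_def by blast
  qed
  obtain D where D: "disjoint_family_on D {..<n + 1}"
    "\<And>i. i < n + 1 \<Longrightarrow> D i \<subseteq> topspace T \<and> dense_over T (topspace T) (D i)"
    using assms(2) unfolding resolvable_iff_splits_over[OF ne] splits_over_def by blast
  \<comment> \<open>Contrapositive of gluing: if splittings existed below every nonempty open set,
    the whole space would be \<omega>-resolvable.\<close>
  obtain W0 where W0: "openin T W0" "W0 \<subseteq> topspace T" "W0 \<noteq> {}"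
    and not_split: "\<And>V. \<lbrakk>openin T V; V \<subseteq> W0; V \<noteq> {}\<rbrakk> \<Longrightarrow> \<not> splits_over (UNIV :: nat set) T V (topspace T)"
    using assms(3) splits_over_glue unfolding resolvable_iff_splits_over[OF ne] by metis
  have "D i \<subseteq> topspace T \<and> dense_over T W0 (D i)" if "i \<in> {..<n}" for i
    using D(2)[of i] that W0(2) dense_over_mono by (metis lessThan_iff order_refl trans_less_add1)
  \<comment> \<open>Only the \<open>D i\<close> with \<open>i < n\<close> are thinned out.
    \<open>D n\<close> is kept in reserve: it is disjoint from \<open>A\<close> and will defeat
    quasi-regularity.\<close>
  then obtain W E where W: "openin T W" "W \<subseteq> W0" "W \<noteq> {}"
    and E: "\<And>i. i < n \<Longrightarrow> E i \<subseteq> D i \<and> dense_over T W (E i) \<and> hereditarily_irresolvable_over T W (E i)"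
    using ex_hereditarily_irresolvable_over_finite[OF _ W0(1,3), of "{..<n}" D "topspace T"] not_split
    by (metis finite_lessThan lessThan_iff)
  define A where "A = W \<inter> (\<Union>i<n. E i)"
  define U where "U = add_open T A"
  have WT: "W \<subseteq> topspace T"
    using W W0 by blast
  have openU: "openin U S \<longleftrightarrow> (\<exists>V V'. openin T V \<and> openin T V' \<and> S = V \<union> V' \<inter> A)" for S
    unfolding U_def by (rule openin_add_open)
  have topU: "topspace U = topspace T"
    unfolding U_def using WT by (intro topspace_add_open) (auto simp: A_def)
  have exp: "expansion_of T U"
    unfolding expansion_of_def topU by (simp add: U_def openin_add_open_mono)
  have openA: "openin U (V \<inter> A)" if "openin T V" for V
    unfolding openU using that by (metis openin_empty sup_bot_left)
  have dense_EA: "V \<inter> E i \<noteq> {}" if "openin T V" "V \<subseteq> W" "V \<noteq> {}" "i < n" for V i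
    using E[OF that(4)] that dense_overD by blast
  have meetA: "V \<inter> A \<noteq> {}" if "openin T V" "V \<subseteq> W" "V \<noteq> {}" for V
    using dense_EA[OF that, of 0] that(2) assms(1) unfolding A_def by fastforce

  have "resolvable {..<n} U"
  proof -
    define F where "F i = (E i \<union> (D i - W)) \<inter> topspace T" for i
    have FD: "F i \<subseteq> D i" if "i < n" for i
      using E[OF that] by (auto simp: F_def)
    have disj: "disjoint_family_on F {..<n}"
      unfolding disjoint_family_on_def
    proof (intro ballI impI)
      fix i j assume ij: "i \<in> {..<n}" "j \<in> {..<n}" "i \<noteq> j"
      then have "D i \<inter> D j = {}"
        using D(1) unfolding disjoint_family_on_def by (simp add: less_SucI)
      then show "F i \<inter> F j = {}"
        using FD[of i] FD[of j] ij by auto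
    qed
    have "dense_over U (topspace U) (F i)" if i: "i < n" for i
      unfolding dense_over_def topU
    proof (intro allI impI)
      fix S assume S: "openin U S \<and> S \<subseteq> topspace T \<and> S \<noteq> {}"
      then obtain V V' where V: "openin T V" "openin T V'" "S = V \<union> V' \<inter> A"
        unfolding openU by blast
      \<comment> \<open>The part \<open>E i\<close> of \<open>F i\<close> handles open sets meeting
        \<open>W\<close>, and \<open>D i - W\<close> those missing it. In the second case a point of
        \<open>V' \<inter> W \<inter> E i\<close> lies in \<open>A\<close>, hence in
        \<open>S\<close>.\<close>
      consider "V \<inter> W \<noteq> {}" | "V' \<inter> A \<noteq> {}" | "V \<noteq> {}" "V \<inter> W = {}"
        using S V(3) by blast
      then show "S \<inter> F i \<noteq> {}"
      proof cases
        case 1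
        then have "V \<inter> W \<inter> E i \<noteq> {}"
          using dense_EA[of "V \<inter> W" i] V(1) W(1) i by blast
        then show ?thesis
          using V(3) WT unfolding F_def by blast
      next
        case 2
        then have "V' \<inter> W \<noteq> {}"
          unfolding A_def by blast
        then have "V' \<inter> W \<inter> E i \<noteq> {}"
          using dense_EA[of "V' \<inter> W" i] V(2) W(1) i by blast
        then show ?thesis
          using V(3) WT i unfolding F_def A_def by blast
      next
        case 3
        then have "V \<inter> D i \<noteq> {}"
          using D(2)[of i] i V(1) openin_subset[OF V(1)] dense_overD
          by (metis trans_less_add1)
        then show ?thesis
          using 3 V(3) openin_subset[OF V(1)] unfolding F_def by blast
      qed
    qed
    moreover have "F i \<subseteq> topspace U" for i
      by (simp add: F_def topU)
    ultimately have "splits_over {..<n} U (topspace U) (topspace U)"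
      unfolding splits_over_def using disj by blast
    then show ?thesis
      using resolvable_iff_splits_over ne topU by metis
  qed

  moreover have "\<not> resolvable {..<n + 1} U"
  proof
    assume "resolvable {..<n + 1} U"
    then obtain G where G: "disjoint_family_on G {..<n + 1}"
      "\<And>j. j < n + 1 \<Longrightarrow> dense_over U (topspace U) (G j)"
      using resolvable_iff_splits_over[of U] ne topU unfolding splits_over_def by (metis lessThan_iff)
    have "\<exists>V. openin T V \<and> V \<subseteq> W \<and> V \<noteq> {} \<and>
        (\<forall>(E', G')\<in>E ` {..<n} \<times> G ` {..<n + 1}. E' \<inter> V \<subseteq> G' \<or> E' \<inter> V \<inter> G' = {})"
      using E W by (intro hereditarily_irresolvable_over_decide_finite) auto
    then obtain V where V: "openin T V" "V \<subseteq> W" "V \<noteq> {}"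
      and decide: "\<And>i j. \<lbrakk>i < n; j < n + 1\<rbrakk> \<Longrightarrow> E i \<inter> V \<subseteq> G j \<or> E i \<inter> V \<inter> G j = {}"
      by fastforce
    \<comment> \<open>\<open>V \<inter> A\<close> is nonempty and open in \<open>U\<close>, so
      \<open>G j\<close> meets it, and thus meets some \<open>E i\<close> inside \<open>V\<close>.
      Of the two alternatives in \<open>decide\<close>, only inclusion is left.\<close>
    have "\<exists>i<n. E i \<inter> V \<subseteq> G j" if j: "j < n + 1" for j
    proof -
      have "V \<inter> A \<inter> G j \<noteq> {}"
        using G(2)[OF j] openA[OF V(1)] meetA[OF V] openin_subset dense_overD by metis
      then obtain i where "i < n" "E i \<inter> V \<inter> G j \<noteq> {}"
        unfolding A_def by blast
      then show ?thesis
        using decide j by blast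
    qed
    then obtain \<phi> where \<phi>: "\<And>j. j < n + 1 \<Longrightarrow> \<phi> j < n \<and> E (\<phi> j) \<inter> V \<subseteq> G j"
      by metis
    \<comment> \<open>A shared value would put the nonempty set
      \<open>E (\<phi> j) \<inter> V\<close> inside two disjoint sets. Injectivity then contradicts
      the pigeonhole principle.\<close>
    have "inj_on \<phi> {..<n + 1}"
    proof (rule inj_onI, rule ccontr)
      fix j k assume jk: "j \<in> {..<n + 1}" "k \<in> {..<n + 1}" "\<phi> j = \<phi> k" "j \<noteq> k"
      then have "E (\<phi> j) \<inter> V \<subseteq> G j \<inter> G k"
        using \<phi>[of j] \<phi>[of k] by auto
      moreover have "G j \<inter> G k = {}"
        using G(1) jk unfolding disjoint_family_on_def by blast
      ultimately show False
        using dense_EA[OF V, of "\<phi> j"] \<phi>[of j] jk(1) by auto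
    qed
    moreover have "\<phi> ` {..<n + 1} \<subseteq> {..<n}"
      using \<phi> by auto
    ultimately have "card {..<n + 1} \<le> card {..<n}"
      by (meson card_inj_on_le finite_lessThan)
    then show False
      by simp
  qed

  moreover have "\<not> quasi_regular U"
  proof
    assume "quasi_regular U"
    moreover have "openin U A" "A \<noteq> {}"
      using openA[OF W(1)] meetA[OF W(1) order_refl W(3)] by (auto simp: A_def Int_absorb1)
    ultimately obtain S where S: "openin U S" "S \<noteq> {}" "U closure_of S \<subseteq> A"
      unfolding quasi_regular_def by blast
    obtain V V' where V: "openin T V" "openin T V'" "S = V \<union> V' \<inter> A"
      using S(1) unfolding openU by blast
    have "S \<subseteq> A"
      using S(3) closure_of_subset[OF openin_subset[OF S(1)]] by blast
    then have S_eq: "S = (V \<union> V') \<inter> A"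
      using V(3) by blast
    \<comment> \<open>\<open>Q\<close> is open in the old topology, lies in \<open>W\<close>, and
      satisfies \<open>Q \<inter> A = S\<close>; being nonempty, it contains a point of
      \<open>D n\<close>.\<close>
    define Q where "Q = (V \<union> V') \<inter> W"
    have Q: "openin T Q" "Q \<subseteq> W" "Q \<noteq> {}"
      using V W(1) S(2) S_eq unfolding Q_def A_def by blast+
    have "Q \<inter> D n \<noteq> {}"
      using D(2)[of n] Q WT dense_overD by (metis less_add_one order_trans)
    then obtain p where p: "p \<in> Q" "p \<in> D n"
      by blast
    have "p \<notin> A"
    proof
      assume "p \<in> A"
      then obtain i where "i < n" "p \<in> D i"
        using E unfolding A_def by blast
      moreover from this(1) have "D i \<inter> D n = {}"
        using D(1) unfolding disjoint_family_on_def by simp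
      ultimately show False
        using p(2) by blast
    qed
    moreover have "p \<in> U closure_of S"
      unfolding in_closure_of
    proof (intro conjI allI impI)
      show "p \<in> topspace U"
        using p Q WT topU by blast
      fix O' assume O': "p \<in> O' \<and> openin U O'"
      then obtain N N' where N: "openin T N" "O' = N \<union> N' \<inter> A"
        unfolding openU by blast
      \<comment> \<open>Since \<open>p\<close> is outside \<open>A\<close>, it lies in
        \<open>N\<close>. So \<open>N \<inter> Q\<close> is a nonempty open subset of
        \<open>W\<close> and meets \<open>A\<close>, necessarily in points of
        \<open>S\<close>.\<close>
      have "N \<inter> Q \<inter> A \<noteq> {}"
        using N O' \<open>p \<notin> A\<close> p(1) Q by (intro meetA) auto
      then show "\<exists>y. y \<in> S \<and> y \<in> O'"
        using N(2) S_eq unfolding Q_def by blast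
    qed
    ultimately show False
      using S(3) by blast
  qed

  ultimately show ?thesis
    using exp unfolding exactly_resolvable_def by blast
qed

end
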